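(* Let $C$ be a small category. Then the following are equivalent: (1) The category $C$ is residually finite. (2) The category $C$ is equivalent to a subcategory of a product $\prod_{i\in I} D_i$ of finite categories $D_i$, indexed over a set $I$.
   Context: Subcategories need not be full. The axiom of choice may be used. A category $D$ is finite if its collection of objects is finite and all sets $\mathrm{Mor}_D(X,Y)$ are finite. Two morphisms $f\in \mathrm{Mor}_C(X,Y)$, $g\in\mathrm{Mor}_C(X',Y')$ of a category $C$ are considered equal if and only if $X=X'$, $Y=Y'$ and $f=g$. A category $C$ is residually finite if for all morphisms $f,g$ in $C$ with $f\neq g$ there exist a finite category $D$ and a functor $F\colon C\to D$ with $F(f)\neq F(g)$. *)

theory Defs
  imports Main "HOL-Library.FuncSet" "HOL-Library.Equipollence" "HOL-Library.Infinite_Typeclass"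
begin

text \<open>
  Every morphism carries its source and target, so that two morphisms of a category are equal only
  if their sources and targets agree. The components are relevant only on the carriers \<open>Obj\<close>
  and \<open>Mor\<close>; \<open>Comp C g f\<close> is the composite ``g after f''.
\<close>

record ('o, 'm) category =
  Obj :: "'o set"
  Mor :: "'m set"
  Src :: "'m \<Rightarrow> 'o"
  Tgt :: "'m \<Rightarrow> 'o"
  Ident :: "'o \<Rightarrow> 'm"
  Comp :: "'m \<Rightarrow> 'm \<Rightarrow> 'm"

definition hom :: "('o, 'm) category \<Rightarrow> 'o \<Rightarrow> 'o \<Rightarrow> 'm set" where
  "hom C X Y = {f \<in> Mor C. Src C f = X \<and> Tgt C f = Y}"

locale category =
  fixes C :: "('o, 'm) category"
  assumes Src_in: "f \<in> Mor C \<Longrightarrow> Src C f \<in> Obj C"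
    and Tgt_in: "f \<in> Mor C \<Longrightarrow> Tgt C f \<in> Obj C"
    and Ident_in: "X \<in> Obj C \<Longrightarrow> Ident C X \<in> hom C X X"
    and Comp_in: "\<lbrakk>f \<in> hom C X Y; g \<in> hom C Y Z\<rbrakk> \<Longrightarrow> Comp C g f \<in> hom C X Z"
    and Comp_Ident: "f \<in> hom C X Y \<Longrightarrow> Comp C f (Ident C X) = f"
    and Ident_Comp: "f \<in> hom C X Y \<Longrightarrow> Comp C (Ident C Y) f = f"
    and Comp_assoc: "\<lbrakk>f \<in> hom C W X; g \<in> hom C X Y; h \<in> hom C Y Z\<rbrakk>
      \<Longrightarrow> Comp C h (Comp C g f) = Comp C (Comp C h g) f"

definition finite_category :: "('o, 'm) category \<Rightarrow> bool" where
  "finite_category D \<longleftrightarrow> category D \<and> finite (Obj D) \<and>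
     (\<forall>X\<in>Obj D. \<forall>Y\<in>Obj D. finite (hom D X Y))"

definition subcategory :: "('o, 'm) category \<Rightarrow> ('o, 'm) category \<Rightarrow> bool" where
  "subcategory S C \<longleftrightarrow> category S \<and> category C \<and> Obj S \<subseteq> Obj C \<and> Mor S \<subseteq> Mor C \<and>
     (\<forall>f\<in>Mor S. Src S f = Src C f \<and> Tgt S f = Tgt C f) \<and>
     (\<forall>X\<in>Obj S. Ident S X = Ident C X) \<and>
     (\<forall>f\<in>Mor S. \<forall>g\<in>Mor S. Tgt S f = Src S g \<longrightarrow> Comp S g f = Comp C g f)"

definition product_category ::
  "'i set \<Rightarrow> ('i \<Rightarrow> ('o, 'm) category) \<Rightarrow> ('i \<Rightarrow> 'o, 'i \<Rightarrow> 'm) category" where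
  "product_category I D =
    \<lparr> Obj = (\<Pi>\<^sub>E i\<in>I. Obj (D i)),
      Mor = (\<Pi>\<^sub>E i\<in>I. Mor (D i)),
      Src = (\<lambda>f. \<lambda>i\<in>I. Src (D i) (f i)),
      Tgt = (\<lambda>f. \<lambda>i\<in>I. Tgt (D i) (f i)),
      Ident = (\<lambda>X. \<lambda>i\<in>I. Ident (D i) (X i)),
      Comp = (\<lambda>g f. \<lambda>i\<in>I. Comp (D i) (g i) (f i)) \<rparr>"

record ('o, 'm, 'p, 'n) cat_functor =
  fobj :: "'o \<Rightarrow> 'p"
  fmor :: "'m \<Rightarrow> 'n"

definition is_functor ::
  "('o, 'm) category \<Rightarrow> ('p, 'n) category \<Rightarrow> ('o, 'm, 'p, 'n) cat_functor \<Rightarrow> bool" where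
  "is_functor C D F \<longleftrightarrow> category C \<and> category D \<and>
     (\<forall>X\<in>Obj C. fobj F X \<in> Obj D) \<and>
     (\<forall>f\<in>Mor C. fmor F f \<in> hom D (fobj F (Src C f)) (fobj F (Tgt C f))) \<and>
     (\<forall>X\<in>Obj C. fmor F (Ident C X) = Ident D (fobj F X)) \<and>
     (\<forall>f\<in>Mor C. \<forall>g\<in>Mor C. Tgt C f = Src C g \<longrightarrow>
        fmor F (Comp C g f) = Comp D (fmor F g) (fmor F f))"

definition id_functor :: "('o, 'm, 'o, 'm) cat_functor" where
  "id_functor = \<lparr> fobj = (\<lambda>X. X), fmor = (\<lambda>f. f) \<rparr>"

definition comp_functor ::
  "('p, 'n, 'q, 'k) cat_functor \<Rightarrow> ('o, 'm, 'p, 'n) cat_functor \<Rightarrow> ('o, 'm, 'q, 'k) cat_functor" where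
  "comp_functor G F = \<lparr> fobj = fobj G \<circ> fobj F, fmor = fmor G \<circ> fmor F \<rparr>"

definition isomorphism :: "('o, 'm) category \<Rightarrow> 'm \<Rightarrow> bool" where
  "isomorphism C f \<longleftrightarrow> f \<in> Mor C \<and>
     (\<exists>g\<in>hom C (Tgt C f) (Src C f).
        Comp C g f = Ident C (Src C f) \<and> Comp C f g = Ident C (Tgt C f))"

definition natural_transformation ::
  "('o, 'm) category \<Rightarrow> ('p, 'n) category \<Rightarrow> ('o, 'm, 'p, 'n) cat_functor
    \<Rightarrow> ('o, 'm, 'p, 'n) cat_functor \<Rightarrow> ('o \<Rightarrow> 'n) \<Rightarrow> bool" where
  "natural_transformation C D F G \<eta> \<longleftrightarrow> is_functor C D F \<and> is_functor C D G \<and>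
     (\<forall>X\<in>Obj C. \<eta> X \<in> hom D (fobj F X) (fobj G X)) \<and>
     (\<forall>f\<in>Mor C. Comp D (\<eta> (Tgt C f)) (fmor F f) = Comp D (fmor G f) (\<eta> (Src C f)))"

definition natural_isomorphism ::
  "('o, 'm) category \<Rightarrow> ('p, 'n) category \<Rightarrow> ('o, 'm, 'p, 'n) cat_functor
    \<Rightarrow> ('o, 'm, 'p, 'n) cat_functor \<Rightarrow> ('o \<Rightarrow> 'n) \<Rightarrow> bool" where
  "natural_isomorphism C D F G \<eta> \<longleftrightarrow>
     natural_transformation C D F G \<eta> \<and> (\<forall>X\<in>Obj C. isomorphism D (\<eta> X))"

definition equivalent_categories :: "('o, 'm) category \<Rightarrow> ('p, 'n) category \<Rightarrow> bool" where
  "equivalent_categories C D \<longleftrightarrow>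
     (\<exists>F G \<eta> \<epsilon>. is_functor C D F \<and> is_functor D C G \<and>
        natural_isomorphism C C id_functor (comp_functor G F) \<eta> \<and>
        natural_isomorphism D D (comp_functor F G) id_functor \<epsilon>)"

text \<open>
  HOL does not allow quantification over types, so existential quantifiers over categories and over
  index sets range over an arbitrary infinite type \<open>'u\<close> that plays the role of the universe
  of small sets: a category is small relative to \<open>'u\<close> if its objects and its morphisms inject
  into \<open>'u\<close>. As \<open>'u\<close> is infinite, every finite category has an isomorphic copy with objects
  and morphisms in \<open>'u\<close>, whence residual finiteness does not depend on the choice of
  \<open>'u\<close>; see \<open>finite_category_copy\<close> and \<open>residually_finite_universe\<close> below.
\<close>

definition small_category :: "'u::infinite itself \<Rightarrow> ('o, 'm) category \<Rightarrow> bool" where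
  "small_category _ C \<longleftrightarrow>
     category C \<and> Obj C \<lesssim> (UNIV :: 'u set) \<and> Mor C \<lesssim> (UNIV :: 'u set)"

definition residually_finite :: "'u::infinite itself \<Rightarrow> ('o, 'm) category \<Rightarrow> bool" where
  "residually_finite _ C \<longleftrightarrow>
     (\<forall>f\<in>Mor C. \<forall>g\<in>Mor C. f \<noteq> g \<longrightarrow>
        (\<exists>(D :: ('u, 'u) category) F.
           finite_category D \<and> is_functor C D F \<and> fmor F f \<noteq> fmor F g))"

lemma category_product_category:
  assumes "\<And>i. i \<in> I \<Longrightarrow> category (D i)"
  shows "category (product_category I D)"
proof -
  have hom_iff: "f \<in> hom (product_category I D) X Y \<longleftrightarrow>
      f \<in> extensional I \<and> X \<in> extensional I \<and> Y \<in> extensional I \<and>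
      (\<forall>i\<in>I. f i \<in> hom (D i) (X i) (Y i))" for f X Y
    by (auto simp: hom_def product_category_def PiE_iff fun_eq_iff restrict_def extensional_def)
  show ?thesis
  proof
    fix X assume "X \<in> Obj (product_category I D)"
    then show "Ident (product_category I D) X \<in> hom (product_category I D) X X"
      unfolding hom_iff using assms
      by (auto simp: product_category_def PiE_iff intro: category.Ident_in)
  next
    fix f g X Y Z
    assume "f \<in> hom (product_category I D) X Y" "g \<in> hom (product_category I D) Y Z"
    then show "Comp (product_category I D) g f \<in> hom (product_category I D) X Z"
      unfolding hom_iff using assms
      by (auto simp: product_category_def intro: category.Comp_in)
  next
    fix f g h W X Y Z
    assume "f \<in> hom (product_category I D) W X" "g \<in> hom (product_category I D) X Y"
      "h \<in> hom (product_category I D) Y Z"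
    then show "Comp (product_category I D) h (Comp (product_category I D) g f) =
        Comp (product_category I D) (Comp (product_category I D) h g) f"
      unfolding hom_iff using assms
      by (auto simp: product_category_def fun_eq_iff restrict_def intro: category.Comp_assoc)
  next
    fix f X Y
    assume "f \<in> hom (product_category I D) X Y"
    then have f: "f \<in> extensional I" "\<And>i. i \<in> I \<Longrightarrow> f i \<in> hom (D i) (X i) (Y i)"
      unfolding hom_iff by auto
    then show "Comp (product_category I D) f (Ident (product_category I D) X) = f"
      "Comp (product_category I D) (Ident (product_category I D) Y) f = f"
      using category.Comp_Ident[OF assms f(2)] category.Ident_Comp[OF assms f(2)]
      by (auto simp: product_category_def fun_eq_iff restrict_def extensional_def)
  qed (use assms in \<open>auto simp: product_category_def PiE_iff
         intro: category.Src_in category.Tgt_in\<close>)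
qed

lemma finite_category_finite_Mor:
  assumes "finite_category D"
  shows "finite (Mor D)"
proof -
  have "Mor D \<subseteq> (\<Union>X\<in>Obj D. \<Union>Y\<in>Obj D. hom D X Y)"
    using assms category.Src_in category.Tgt_in
    by (fastforce simp: finite_category_def hom_def)
  then show ?thesis
    using assms by (auto simp: finite_category_def intro: finite_subset)
qed

lemma ex_inj_on_infinite:
  assumes "finite A"
  shows "\<exists>h :: 'a \<Rightarrow> 'u::infinite. inj_on h A"
proof -
  obtain B :: "'u set" where "finite B" "card B = card A"
    using infinite_arbitrarily_large[OF infinite_UNIV] by blast
  then show ?thesis
    using assms by (metis bij_betw_def finite_same_card_bij)
qed

lemma finite_category_copy:
  fixes D :: "('a, 'b) category"
  assumes "finite_category D"
  shows "\<exists>(D' :: ('u::infinite, 'u) category) F. finite_category D' \<and> is_functor D D' F \<and>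
    bij_betw (fobj F) (Obj D) (Obj D') \<and> bij_betw (fmor F) (Mor D) (Mor D')"
proof -
  interpret D: category D using assms by (simp add: finite_category_def)
  have finO: "finite (Obj D)" and finM: "finite (Mor D)"
    using assms finite_category_finite_Mor by (auto simp: finite_category_def)
  obtain h :: "'a \<Rightarrow> 'u" where h: "inj_on h (Obj D)" using ex_inj_on_infinite[OF finO] by blast
  obtain k :: "'b \<Rightarrow> 'u" where k: "inj_on k (Mor D)" using ex_inj_on_infinite[OF finM] by blast
  define h' where "h' = inv_into (Obj D) h"
  define k' where "k' = inv_into (Mor D) k"
  have h'h: "h' (h X) = X" if "X \<in> Obj D" for X using that h by (simp add: h'_def)
  have k'k: "k' (k f) = f" if "f \<in> Mor D" for f using that k by (simp add: k'_def)
  define D' where "D' = \<lparr> Obj = h ` Obj D, Mor = k ` Mor D, Src = (\<lambda>f. h (Src D (k' f))),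
    Tgt = (\<lambda>f. h (Tgt D (k' f))), Ident = (\<lambda>X. k (Ident D (h' X))),
    Comp = (\<lambda>g f. k (Comp D (k' g) (k' f))) \<rparr>"
  define F where "F = \<lparr> fobj = h, fmor = k \<rparr>"
  have homM: "f \<in> hom D X Y \<Longrightarrow> f \<in> Mor D" for f X Y by (simp add: hom_def)
  have Ident_Mor: "X \<in> Obj D \<Longrightarrow> Ident D X \<in> Mor D" for X using D.Ident_in homM by blast
  have hom': "\<exists>f0 X0 Y0. f = k f0 \<and> X = h X0 \<and> Y = h Y0 \<and> f0 \<in> hom D X0 Y0 \<and>
      X0 \<in> Obj D \<and> Y0 \<in> Obj D" if "f \<in> hom D' X Y" for f X Y
    using that k'k D.Src_in D.Tgt_in by (auto simp: hom_def D'_def)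
  have homI: "k f0 \<in> hom D' (h X0) (h Y0)" if "f0 \<in> hom D X0 Y0" for f0 X0 Y0
    using that k'k by (auto simp: hom_def D'_def)
  have hinj: "X = Y" if "h X = h Y" "X \<in> Obj D" "Y \<in> Obj D" for X Y
    using that h by (auto dest: inj_onD)
  have Compk: "Comp D' (k g) (k f) = k (Comp D g f)" if "f \<in> Mor D" "g \<in> Mor D" for f g
    using that k'k by (simp add: D'_def)
  have Identh: "Ident D' (h X) = k (Ident D X)" if "X \<in> Obj D" for X
    using that h'h by (simp add: D'_def)
  have cat: "category D'"
  proof
    fix f assume "f \<in> Mor D'"
    then show "Src D' f \<in> Obj D'" "Tgt D' f \<in> Obj D'"
      using k'k D.Src_in D.Tgt_in by (auto simp: D'_def)
  next
    fix X assume "X \<in> Obj D'"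
    then obtain X0 where "X = h X0" "X0 \<in> Obj D" by (auto simp: D'_def)
    then show "Ident D' X \<in> hom D' X X" using homI D.Ident_in Identh by auto
  next
    fix f g X Y Z assume "f \<in> hom D' X Y" "g \<in> hom D' Y Z"
    from hom'[OF this(1)] hom'[OF this(2)] show "Comp D' g f \<in> hom D' X Z"
      using homI D.Comp_in Compk homM hinj by metis
  next
    fix f X Y assume "f \<in> hom D' X Y"
    from hom'[OF this] show "Comp D' f (Ident D' X) = f" "Comp D' (Ident D' Y) f = f"
      using D.Comp_Ident D.Ident_Comp Compk Identh homM Ident_Mor by metis+
  next
    fix f g l W X Y Z assume a: "f \<in> hom D' W X" "g \<in> hom D' X Y" "l \<in> hom D' Y Z"
    obtain f0 W0 X0 where f: "f = k f0" "X = h X0" "f0 \<in> hom D W0 X0" "X0 \<in> Obj D"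
      using hom'[OF a(1)] by blast
    obtain g0 Y0 where g: "g = k g0" "Y = h Y0" "g0 \<in> hom D X0 Y0" "Y0 \<in> Obj D"
      using hom'[OF a(2)] f hinj by metis
    obtain l0 Z0 where l: "l = k l0" "l0 \<in> hom D Y0 Z0"
      using hom'[OF a(3)] g hinj by metis
    show "Comp D' l (Comp D' g f) = Comp D' (Comp D' l g) f"
      using f g l D.Comp_assoc[OF f(3) g(3) l(2)] D.Comp_in[OF f(3) g(3)] D.Comp_in[OF g(3) l(2)]
      by (simp add: Compk homM)
  qed
  moreover have "finite_category D'"
    using cat finO finM by (auto simp: finite_category_def hom_def D'_def)
  moreover have "is_functor D D' F"
    using cat D.category_axioms homI Compk Identh
    by (auto simp: is_functor_def F_def hom_def) (auto simp: D'_def)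
  moreover have "bij_betw (fobj F) (Obj D) (Obj D')" "bij_betw (fmor F) (Mor D) (Mor D')"
    using h k by (auto simp: bij_betw_def F_def D'_def)
  ultimately show ?thesis by blast
qed

lemma is_functor_comp:
  assumes "is_functor C D F" "is_functor D E G"
  shows "is_functor C E (comp_functor G F)"
  using assms by (auto simp: is_functor_def comp_functor_def hom_def)

lemma residually_finite_universe:
  assumes "residually_finite TYPE('u::infinite) C"
  shows "residually_finite TYPE('v::infinite) C"
  unfolding residually_finite_def
proof (intro ballI impI)
  fix f g assume fg: "f \<in> Mor C" "g \<in> Mor C" "f \<noteq> g"
  then obtain D :: "('u, 'u) category" and F
    where D: "finite_category D" "is_functor C D F" "fmor F f \<noteq> fmor F g"
    using assms unfolding residually_finite_def by blast
  obtain D' :: "('v, 'v) category" and G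
    where D': "finite_category D'" "is_functor D D' G" "bij_betw (fmor G) (Mor D) (Mor D')"
    using finite_category_copy[OF D(1)] by blast
  have "fmor F f \<in> Mor D" "fmor F g \<in> Mor D"
    using D(2) fg by (auto simp: is_functor_def hom_def)
  then have "fmor (comp_functor G F) f \<noteq> fmor (comp_functor G F) g"
    using D'(3) D(3) by (auto simp: comp_functor_def bij_betw_def dest: inj_onD)
  then show "\<exists>(D :: ('v, 'v) category) F.
      finite_category D \<and> is_functor C D F \<and> fmor F f \<noteq> fmor F g"
    using D'(1) is_functor_comp[OF D(2) D'(2)] by blast
qed

end

theory Submission imports Defs begin

text \<open>
  If \<open>C\<close> is residually finite, choose for each pair of distinct morphisms a functor to a finite
  category separating them, and combine these functors into a single functor to the product
  of their targets. It is injective on morphisms, and therefore on objects, because distinct objects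
  have distinct identities. Injectivity on objects is what makes the image closed under
  composition: two composable morphisms of the image then come from composable morphisms of \<open>C\<close>. So
  the image is a subcategory, isomorphic to \<open>C\<close>. The index set consists of pairs of morphisms of
  \<open>C\<close>, so it fits into the infinite universe because the square of an infinite set injects into the
  set itself.

  Conversely, let \<open>C\<close> be equivalent to a subcategory of a product of finite categories, and let
  \<open>f \<noteq> g\<close> be morphisms of \<open>C\<close>. If they are parallel, then an equivalence, being faithful, keeps them
  apart, and some projection of the product separates their images. An equivalence may however
  identify distinct objects, and so may fail to separate \<open>f\<close> from \<open>g\<close> when their sources or targets
  differ. In that case a separating functor exists for any category \<open>C\<close>: every map from the objects of \<open>C\<close> to a set of two elements extends to a
  functor to the category with these two objects and exactly one morphism between any two of them.
\<close>

section \<open>The image of a functor that is injective on morphisms\<close>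

lemma (in category) Mor_hom: "f \<in> Mor C \<Longrightarrow> f \<in> hom C (Src C f) (Tgt C f)"
  by (simp add: hom_def)

lemma (in category) Ident_simps:
  assumes "X \<in> Obj C"
  shows "Ident C X \<in> Mor C" "Src C (Ident C X) = X" "Tgt C (Ident C X) = X"
  using Ident_in[OF assms] by (auto simp: hom_def)

lemma (in category) isomorphism_Ident:
  assumes "X \<in> Obj C"
  shows "isomorphism C (Ident C X)"
  unfolding isomorphism_def
  using Ident_simps[OF assms] Ident_in[OF assms] Comp_Ident[OF Ident_in[OF assms]] by auto

lemma is_functor_Mor:
  assumes "is_functor C D F" "f \<in> Mor C"
  shows "fmor F f \<in> Mor D" "Src D (fmor F f) = fobj F (Src C f)"
    "Tgt D (fmor F f) = fobj F (Tgt C f)"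
  using assms by (auto simp: is_functor_def hom_def)

lemma natural_isomorphism_Ident:
  assumes F: "is_functor C D F" and G: "is_functor C D G"
    and obj: "\<And>X. X \<in> Obj C \<Longrightarrow> fobj G X = fobj F X"
    and mor: "\<And>f. f \<in> Mor C \<Longrightarrow> fmor G f = fmor F f"
  shows "natural_isomorphism C D F G (\<lambda>X. Ident D (fobj F X))"
proof -
  interpret C: category C using F by (simp add: is_functor_def)
  interpret D: category D using F by (simp add: is_functor_def)
  have F_obj: "fobj F X \<in> Obj D" if "X \<in> Obj C" for X
    using F that by (simp add: is_functor_def)
  have F_hom: "fmor F f \<in> hom D (fobj F (Src C f)) (fobj F (Tgt C f))" if "f \<in> Mor C" for f
    using F that by (simp add: is_functor_def)
  show ?thesis
    unfolding natural_isomorphism_def natural_transformation_def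
    using F G
    by (simp add: obj mor F_obj D.Ident_in D.isomorphism_Ident
        D.Comp_Ident[OF F_hom] D.Ident_Comp[OF F_hom])
qed

lemma is_functor_id: "category C \<Longrightarrow> is_functor C C id_functor"
  by (simp add: is_functor_def id_functor_def category.Mor_hom)

lemma equivalent_categories_if_mutually_inverse:
  assumes F: "is_functor C D F" and G: "is_functor D C G"
    and "\<And>X. X \<in> Obj C \<Longrightarrow> fobj G (fobj F X) = X" "\<And>f. f \<in> Mor C \<Longrightarrow> fmor G (fmor F f) = f"
    and "\<And>Y. Y \<in> Obj D \<Longrightarrow> fobj F (fobj G Y) = Y" "\<And>h. h \<in> Mor D \<Longrightarrow> fmor F (fmor G h) = h"
  shows "equivalent_categories C D"
proof -
  have "category C" "category D" using F by (simp_all add: is_functor_def)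
  have "\<exists>\<eta>. natural_isomorphism C C id_functor (comp_functor G F) \<eta>"
    by (rule exI, rule natural_isomorphism_Ident[OF is_functor_id[OF \<open>category C\<close>] is_functor_comp[OF F G]])
      (simp_all add: id_functor_def comp_functor_def assms)
  moreover have "\<exists>\<epsilon>. natural_isomorphism D D (comp_functor F G) id_functor \<epsilon>"
    by (rule exI, rule natural_isomorphism_Ident[OF is_functor_comp[OF G F] is_functor_id[OF \<open>category D\<close>]])
      (simp_all add: id_functor_def comp_functor_def assms)
  ultimately show ?thesis
    unfolding equivalent_categories_def using F G by blast
qed

text \<open>An object can be recovered from its identity.\<close>

lemma inj_on_fobj_if_inj_on_fmor:
  assumes F: "is_functor C P F" and inj: "inj_on (fmor F) (Mor C)"
  shows "inj_on (fobj F) (Obj C)"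
proof (rule inj_onI)
  interpret C: category C using F by (simp add: is_functor_def)
  fix X Y assume XY: "X \<in> Obj C" "Y \<in> Obj C" "fobj F X = fobj F Y"
  then have "fmor F (Ident C X) = fmor F (Ident C Y)"
    using F by (simp add: is_functor_def)
  then have "Ident C X = Ident C Y"
    using inj XY C.Ident_simps by (auto dest: inj_onD)
  then show "X = Y" using XY C.Ident_simps by metis
qed

definition image_category ::
  "('o, 'm) category \<Rightarrow> ('p, 'n) category \<Rightarrow> ('o, 'm, 'p, 'n) cat_functor \<Rightarrow> ('p, 'n) category" where
  "image_category C P F =
    \<lparr> Obj = fobj F ` Obj C, Mor = fmor F ` Mor C, Src = Src P, Tgt = Tgt P,
      Ident = Ident P, Comp = Comp P \<rparr>"

lemma
  assumes F: "is_functor C P F" and inj: "inj_on (fmor F) (Mor C)"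
  shows subcategory_image_category: "subcategory (image_category C P F) P"
    and equivalent_image_category: "equivalent_categories C (image_category C P F)"
proof -
  let ?S = "image_category C P F"
  interpret C: category C using F by (simp add: is_functor_def)
  interpret P: category P using F by (simp add: is_functor_def)
  note inj_obj = inj_on_fobj_if_inj_on_fmor[OF F inj]
  note F_Mor = is_functor_Mor[OF F]
  have F_Obj: "fobj F X \<in> Obj P" if "X \<in> Obj C" for X
    using F that by (simp add: is_functor_def)
  have F_Ident: "fmor F (Ident C X) = Ident P (fobj F X)" if "X \<in> Obj C" for X
    using F that by (simp add: is_functor_def)
  have F_Comp: "fmor F (Comp C g f) = Comp P (fmor F g) (fmor F f)"
    if "f \<in> Mor C" "g \<in> Mor C" "Tgt C f = Src C g" for f g
    using F that by (simp add: is_functor_def)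
  have S_simps: "Obj ?S = fobj F ` Obj C" "Mor ?S = fmor F ` Mor C" "Src ?S = Src P"
    "Tgt ?S = Tgt P" "Ident ?S = Ident P" "Comp ?S = Comp P"
    by (simp_all add: image_category_def)
  have hom_S: "h \<in> hom ?S A B \<longleftrightarrow> h \<in> fmor F ` Mor C \<and> h \<in> hom P A B" for h A B
    using F_Mor by (auto simp: hom_def S_simps)
  have composable: "Tgt C f = Src C g"
    if "f \<in> Mor C" "g \<in> Mor C" "fobj F (Tgt C f) = fobj F (Src C g)" for f g
    using inj_onD[OF inj_obj that(3)] that C.Src_in C.Tgt_in by blast
  have Comp_Mor: "Comp C g f \<in> Mor C"
    if "f \<in> Mor C" "g \<in> Mor C" "Tgt C f = Src C g" for f g
    using C.Comp_in[of f "Src C f" "Tgt C f" g "Tgt C g"] that by (auto simp: hom_def)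
  have cat: "category ?S"
  proof
    fix h assume "h \<in> Mor ?S"
    then show "Src ?S h \<in> Obj ?S" "Tgt ?S h \<in> Obj ?S"
      using F_Mor C.Src_in C.Tgt_in by (auto simp: S_simps)
  next
    fix A assume "A \<in> Obj ?S"
    then obtain X where X: "X \<in> Obj C" "A = fobj F X" by (auto simp: S_simps)
    then have "Ident P A \<in> fmor F ` Mor C"
      using F_Ident C.Ident_simps by (metis imageI)
    then show "Ident ?S A \<in> hom ?S A A"
      using X F_Obj P.Ident_in by (simp add: hom_S S_simps(5))
  next
    fix h k A B E assume hk: "h \<in> hom ?S A B" "k \<in> hom ?S B E"
    then obtain f g where fg: "f \<in> Mor C" "h = fmor F f" "g \<in> Mor C" "k = fmor F g"
      by (auto simp: hom_S)
    then have "Tgt C f = Src C g"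
      using hk F_Mor unfolding hom_S by (intro composable) (auto simp: hom_def)
    then have "Comp P k h \<in> fmor F ` Mor C"
      using fg F_Comp Comp_Mor by (metis imageI)
    then show "Comp ?S k h \<in> hom ?S A E"
      using hk P.Comp_in unfolding hom_S S_simps(6) by blast
  qed (auto simp: hom_S S_simps(5,6) intro: P.Comp_Ident P.Ident_Comp P.Comp_assoc)
  then show "subcategory ?S P"
    unfolding subcategory_def using P.category_axioms F_Obj F_Mor by (auto simp: S_simps)
  define G where
    "G = \<lparr> fobj = inv_into (Obj C) (fobj F), fmor = inv_into (Mor C) (fmor F) \<rparr>"
  have GF_obj: "fobj G (fobj F X) = X" if "X \<in> Obj C" for X
    using that inj_obj by (simp add: G_def)
  have GF_mor: "fmor G (fmor F f) = f" if "f \<in> Mor C" for f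
    using that inj by (simp add: G_def)
  have F_S: "is_functor C ?S F"
    using F cat by (auto simp: is_functor_def hom_S S_simps(1,5,6))
  have "is_functor ?S C G"
    unfolding is_functor_def
  proof (intro conjI ballI impI)
    fix A assume "A \<in> Obj ?S"
    then obtain X where X: "X \<in> Obj C" "A = fobj F X" by (auto simp: S_simps)
    then show "fobj G A \<in> Obj C" using GF_obj by simp
    have "fmor G (fmor F (Ident C X)) = Ident C (fobj G (fobj F X))"
      using X GF_obj GF_mor C.Ident_simps by simp
    then show "fmor G (Ident ?S A) = Ident C (fobj G A)"
      using X F_Ident by (simp add: S_simps)
  next
    fix h assume "h \<in> Mor ?S"
    then obtain f where "f \<in> Mor C" "h = fmor F f" by (auto simp: S_simps)
    then show "fmor G h \<in> hom C (fobj G (Src ?S h)) (fobj G (Tgt ?S h))"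
      using F_Mor GF_obj GF_mor C.Src_in C.Tgt_in by (simp add: S_simps hom_def)
  next
    fix h k assume hk: "h \<in> Mor ?S" "k \<in> Mor ?S" "Tgt ?S h = Src ?S k"
    then obtain f g where fg: "f \<in> Mor C" "h = fmor F f" "g \<in> Mor C" "k = fmor F g"
      by (auto simp: S_simps)
    then have *: "Tgt C f = Src C g"
      using hk F_Mor by (intro composable) (auto simp: S_simps)
    then have "fmor G (fmor F (Comp C g f)) = Comp C g f"
      using fg GF_mor Comp_Mor by blast
    then show "fmor G (Comp ?S k h) = Comp C (fmor G k) (fmor G h)"
      using fg * GF_mor F_Comp by (simp add: S_simps)
  qed (fact cat C.category_axioms)+
  then show "equivalent_categories C ?S"
    by (rule equivalent_categories_if_mutually_inverse[OF F_S])
      (auto simp: S_simps GF_obj GF_mor)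
qed

section \<open>Functors into and out of a product\<close>

definition tuple_functor ::
  "'i set \<Rightarrow> ('i \<Rightarrow> ('o, 'm, 'p, 'n) cat_functor) \<Rightarrow> ('o, 'm, 'i \<Rightarrow> 'p, 'i \<Rightarrow> 'n) cat_functor" where
  "tuple_functor I F =
    \<lparr> fobj = (\<lambda>X. \<lambda>i\<in>I. fobj (F i) X), fmor = (\<lambda>f. \<lambda>i\<in>I. fmor (F i) f) \<rparr>"

lemma is_functor_tuple:
  assumes C: "category C" and F: "\<And>i. i \<in> I \<Longrightarrow> is_functor C (D i) (F i)"
  shows "is_functor C (product_category I D) (tuple_functor I F)"
proof -
  have "category (product_category I D)"
    using F by (intro category_product_category) (simp add: is_functor_def)
  then show ?thesis
    using C F
    by (auto simp: is_functor_def tuple_functor_def product_category_def hom_def fun_eq_iff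
        restrict_def PiE_iff extensional_def)
qed

definition proj_functor :: "'i \<Rightarrow> ('i \<Rightarrow> 'o, 'i \<Rightarrow> 'm, 'o, 'm) cat_functor" where
  "proj_functor i = \<lparr> fobj = (\<lambda>X. X i), fmor = (\<lambda>f. f i) \<rparr>"

lemma is_functor_proj:
  assumes D: "\<And>i. i \<in> I \<Longrightarrow> category (D i)" and "i \<in> I"
  shows "is_functor (product_category I D) (D i) (proj_functor i)"
  using category_product_category[OF D] assms
  by (auto simp: is_functor_def proj_functor_def product_category_def hom_def PiE_iff)

lemma is_functor_subcategory:
  assumes "subcategory S P"
  shows "is_functor S P id_functor"
  using assms by (auto simp: is_functor_def subcategory_def id_functor_def hom_def)

section \<open>Separating morphisms\<close>

text \<open>Naturality of the unit \<open>\<eta>\<close> gives \<open>\<eta> \<circ> f = G (F f) \<circ> \<eta>\<close>, where \<open>\<eta>\<close> can be cancelled on the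
  left. For morphisms that are not parallel, the two instances of this equation involve different
  components of \<open>\<eta>\<close>, and the argument breaks down.\<close>

lemma faithful_if_unit_natural_isomorphism:
  assumes \<eta>: "natural_isomorphism C C id_functor (comp_functor G F) \<eta>"
    and f: "f \<in> hom C X Y" and g: "g \<in> hom C X Y" and eq: "fmor F f = fmor F g"
  shows "f = g"
proof -
  interpret C: category C
    using \<eta> by (simp add: natural_isomorphism_def natural_transformation_def is_functor_def)
  let ?Z = "fobj (comp_functor G F) Y"
  have Y: "Y \<in> Obj C" using f C.Tgt_in by (auto simp: hom_def)
  then have \<eta>_hom: "\<eta> Y \<in> hom C Y ?Z" and "isomorphism C (\<eta> Y)"
    using \<eta> by (auto simp: natural_isomorphism_def natural_transformation_def id_functor_def)
  then obtain e where e: "e \<in> hom C ?Z Y" "Comp C e (\<eta> Y) = Ident C Y"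
    by (auto simp: isomorphism_def hom_def)
  have nat: "Comp C (\<eta> Y) h = Comp C (fmor G (fmor F h)) (\<eta> X)" if "h \<in> hom C X Y" for h
    using \<eta> that
    by (auto simp: natural_isomorphism_def natural_transformation_def id_functor_def
        comp_functor_def hom_def)
  have cancel: "Comp C e (Comp C (\<eta> Y) h) = h" if "h \<in> hom C X Y" for h
    using C.Comp_assoc[OF that \<eta>_hom e(1)] e(2) C.Ident_Comp[OF that] by simp
  show "f = g" using cancel[OF f] cancel[OF g] nat[OF f] nat[OF g] eq by simp
qed

definition indiscrete_category :: "'a set \<Rightarrow> ('a, 'a \<times> 'a) category" where
  "indiscrete_category A =
    \<lparr> Obj = A, Mor = A \<times> A, Src = fst, Tgt = snd, Ident = (\<lambda>a. (a, a)),
      Comp = (\<lambda>g f. (fst f, snd g)) \<rparr>"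

lemma category_indiscrete: "category (indiscrete_category A)"
  by unfold_locales (auto simp: indiscrete_category_def hom_def)

lemma finite_category_indiscrete: "finite A \<Longrightarrow> finite_category (indiscrete_category A)"
  using category_indiscrete[of A]
  by (auto simp: finite_category_def indiscrete_category_def hom_def)

text \<open>An indiscrete category has exactly one morphism between any two objects, so each map \<open>c\<close> on objects is the
  object part of a functor.\<close>

lemma is_functor_indiscrete:
  assumes "category C" and "\<And>X. X \<in> Obj C \<Longrightarrow> c X \<in> A"
  shows "is_functor C (indiscrete_category A)
    \<lparr> fobj = c, fmor = (\<lambda>f. (c (Src C f), c (Tgt C f))) \<rparr>"
proof -
  interpret C: category C by fact
  have "Src C (Comp C g f) = Src C f \<and> Tgt C (Comp C g f) = Tgt C g"
    if "f \<in> Mor C" "g \<in> Mor C" "Tgt C f = Src C g" for f g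
    using C.Comp_in[of f "Src C f" "Tgt C f" g "Tgt C g"] that by (auto simp: hom_def)
  then show ?thesis
    using assms category_indiscrete C.Src_in C.Tgt_in C.Ident_simps
    by (simp add: is_functor_def hom_def indiscrete_category_def)
qed

text \<open>The characteristic function of a single object suffices as the object map: a source or a
  target in which \<open>f\<close> and \<open>g\<close> differ.\<close>

lemma nonparallel_separated:
  assumes C: "category C" and neq: "Src C f \<noteq> Src C g \<or> Tgt C f \<noteq> Tgt C g"
  shows "\<exists>(D :: (bool, bool \<times> bool) category) F.
    finite_category D \<and> is_functor C D F \<and> fmor F f \<noteq> fmor F g"
proof -
  define X where "X = (if Src C f \<noteq> Src C g then Src C f else Tgt C f)"
  let ?F = "\<lparr> fobj = (\<lambda>Y. Y = X), fmor = (\<lambda>h. (Src C h = X, Tgt C h = X)) \<rparr>"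
  have "is_functor C (indiscrete_category UNIV) ?F"
    using is_functor_indiscrete[OF C, of "\<lambda>Y. Y = X" UNIV] by simp
  moreover have "fmor ?F f \<noteq> fmor ?F g" using neq by (auto simp: X_def)
  ultimately show ?thesis using finite_category_indiscrete[OF finite_UNIV] by blast
qed

lemma separated_in_universe:
  fixes D :: "('a, 'b) category"
  assumes D: "finite_category D" and F: "is_functor C D F"
    and fg: "f \<in> Mor C" "g \<in> Mor C" "fmor F f \<noteq> fmor F g"
  shows "\<exists>(D :: ('u::infinite, 'u) category) F.
    finite_category D \<and> is_functor C D F \<and> fmor F f \<noteq> fmor F g"
proof -
  obtain D' :: "('u, 'u) category" and K
    where K: "finite_category D'" "is_functor D D' K" "bij_betw (fmor K) (Mor D) (Mor D')"
    using finite_category_copy[OF D] by blast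
  have "fmor (comp_functor K F) f \<noteq> fmor (comp_functor K F) g"
    using K(3) fg is_functor_Mor(1)[OF F]
    by (auto simp: comp_functor_def bij_betw_def dest: inj_onD)
  then show ?thesis using K(1) is_functor_comp[OF F K(2)] by blast
qed

section \<open>The equivalence\<close>

lemma Times_lepoll_infinite_UNIV:
  assumes "A \<lesssim> (UNIV :: 'u::infinite set)" "B \<lesssim> (UNIV :: 'u set)"
  shows "A \<times> B \<lesssim> (UNIV :: 'u set)"
proof -
  have "A \<times> B \<lesssim> (UNIV :: 'u set) \<times> (UNIV :: 'u set)"
    by (rule times_lepoll_mono[OF assms])
  also have "\<dots> \<approx> (UNIV :: 'u set)"
    unfolding eqpoll_iff_card_of_ordIso by (rule card_of_Times_same_infinite[OF infinite_UNIV])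
  finally show ?thesis .
qed

lemma equivalent_to_subcategory_if_residually_finite:
  fixes C :: "('o, 'm) category"
  assumes small: "small_category TYPE('u::infinite) C" and rf: "residually_finite TYPE('u) C"
  shows "\<exists>(I :: 'u set) (D :: 'u \<Rightarrow> ('u, 'u) category) S.
    (\<forall>i\<in>I. finite_category (D i)) \<and> subcategory S (product_category I D) \<and>
    equivalent_categories C S"
proof -
  have "category C" and "Mor C \<times> Mor C \<lesssim> (UNIV :: 'u set)"
    using small by (auto simp: small_category_def intro: Times_lepoll_infinite_UNIV)
  then obtain e :: "'m \<times> 'm \<Rightarrow> 'u" where e: "inj_on e (Mor C \<times> Mor C)"
    by (auto simp: lepoll_def)
  define pairs where "pairs = {(f, g). f \<in> Mor C \<and> g \<in> Mor C \<and> f \<noteq> g}"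
  let ?I = "e ` pairs"
  have "inj_on e pairs"
    using e by (rule inj_on_subset) (auto simp: pairs_def)
  define d where "d = inv_into pairs e"
  have d_e: "d (e p) = p" if "p \<in> pairs" for p
    using that \<open>inj_on e pairs\<close> by (simp add: d_def)
  have "\<forall>i\<in>?I. \<exists>(D :: ('u, 'u) category) F. finite_category D \<and> is_functor C D F \<and>
      fmor F (fst (d i)) \<noteq> fmor F (snd (d i))"
  proof
    fix i assume "i \<in> ?I"
    then have "d i \<in> pairs" unfolding d_def by (rule inv_into_into)
    then have "fst (d i) \<in> Mor C" "snd (d i) \<in> Mor C" "fst (d i) \<noteq> snd (d i)"
      by (auto simp: pairs_def)
    then show "\<exists>(D :: ('u, 'u) category) F. finite_category D \<and> is_functor C D F \<and>
        fmor F (fst (d i)) \<noteq> fmor F (snd (d i))"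
      using rf unfolding residually_finite_def by blast
  qed
  from bchoice[OF this] obtain D :: "'u \<Rightarrow> ('u, 'u) category" where
    "\<forall>i\<in>?I. \<exists>F. finite_category (D i) \<and> is_functor C (D i) F \<and>
      fmor F (fst (d i)) \<noteq> fmor F (snd (d i))" ..
  from bchoice[OF this] obtain F where
    D: "\<forall>i\<in>?I. finite_category (D i) \<and> is_functor C (D i) (F i) \<and>
      fmor (F i) (fst (d i)) \<noteq> fmor (F i) (snd (d i))" ..
  let ?T = "tuple_functor ?I F"
  have T: "is_functor C (product_category ?I D) ?T"
    using D by (intro is_functor_tuple \<open>category C\<close>) blast
  have inj: "inj_on (fmor ?T) (Mor C)"
  proof (rule inj_onI, rule ccontr)
    fix f g assume fg: "f \<in> Mor C" "g \<in> Mor C" "fmor ?T f = fmor ?T g" "f \<noteq> g"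
    then have i: "(f, g) \<in> pairs" "e (f, g) \<in> ?I" by (auto simp: pairs_def)
    then have "fmor (F (e (f, g))) f = fmor (F (e (f, g))) g"
      using fun_cong[OF fg(3), of "e (f, g)"] by (simp add: tuple_functor_def)
    moreover have "fmor (F (e (f, g))) f \<noteq> fmor (F (e (f, g))) g"
      using bspec[OF D i(2)] d_e[OF i(1)] by simp
    ultimately show False by simp
  qed
  show ?thesis
    using D subcategory_image_category[OF T inj] equivalent_image_category[OF T inj]
    by blast
qed

lemma residually_finite_if_equivalent_to_subcategory:
  fixes C :: "('o, 'm) category" and D :: "'i \<Rightarrow> ('p, 'n) category"
  assumes D: "\<forall>i\<in>I. finite_category (D i)"
    and S: "subcategory S (product_category I D)" and equiv: "equivalent_categories C S"
  shows "residually_finite TYPE('u::infinite) C"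
  unfolding residually_finite_def
proof (intro ballI impI)
  fix f g assume fg: "f \<in> Mor C" "g \<in> Mor C" "f \<noteq> g"
  obtain F G \<eta> where F: "is_functor C S F"
    and \<eta>: "natural_isomorphism C C id_functor (comp_functor G F) \<eta>"
    using equiv unfolding equivalent_categories_def by blast
  show "\<exists>(D :: ('u, 'u) category) F.
    finite_category D \<and> is_functor C D F \<and> fmor F f \<noteq> fmor F g"
  proof (cases "Src C f = Src C g \<and> Tgt C f = Tgt C g")
    case True
    then have "f \<in> hom C (Src C f) (Tgt C f)" "g \<in> hom C (Src C f) (Tgt C f)"
      using fg by (auto simp: hom_def)
    from faithful_if_unit_natural_isomorphism[OF \<eta> this] have neq: "fmor F f \<noteq> fmor F g"
      using fg(3) by blast
    have "Mor S \<subseteq> Mor (product_category I D)" using S by (simp add: subcategory_def)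
    then have "fmor F f \<in> Mor (product_category I D)" "fmor F g \<in> Mor (product_category I D)"
      using is_functor_Mor(1)[OF F fg(1)] is_functor_Mor(1)[OF F fg(2)] by auto
    then have "fmor F f \<in> extensional I" "fmor F g \<in> extensional I"
      by (simp_all add: product_category_def PiE_iff)
    from extensionalityI[OF this] obtain i where i: "i \<in> I" "fmor F f i \<noteq> fmor F g i"
      using neq by auto
    let ?K = "comp_functor (proj_functor i) (comp_functor id_functor F)"
    have "is_functor (product_category I D) (D i) (proj_functor i)"
      using D i(1) by (intro is_functor_proj) (simp_all add: finite_category_def)
    then have K: "is_functor C (D i) ?K"
      by (rule is_functor_comp[OF is_functor_comp[OF F is_functor_subcategory[OF S]]])
    have "fmor ?K f \<noteq> fmor ?K g"
      using i(2) by (simp add: comp_functor_def proj_functor_def id_functor_def)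
    then show ?thesis
      by (rule separated_in_universe[OF bspec[OF D i(1)] K fg(1,2)])
  next
    case False
    have "category C" using F by (simp add: is_functor_def)
    moreover have "Src C f \<noteq> Src C g \<or> Tgt C f \<noteq> Tgt C g" using False by simp
    ultimately have "\<exists>(E :: (bool, bool \<times> bool) category) K.
        finite_category E \<and> is_functor C E K \<and> fmor K f \<noteq> fmor K g"
      by (rule nonparallel_separated)
    then obtain E :: "(bool, bool \<times> bool) category" and K
      where "finite_category E" "is_functor C E K" and "fmor K f \<noteq> fmor K g"
      by blast
    from separated_in_universe[OF this(1,2) fg(1,2) this(3)] show ?thesis .
  qed
qed

theorem corollary3p7:
  fixes C :: "('o, 'm) category"
  assumes "small_category TYPE('u::infinite) C"
  shows "residually_finite TYPE('u) C \<longleftrightarrow>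
    (\<exists>(I :: 'u set) (D :: 'u \<Rightarrow> ('u, 'u) category) S.
       (\<forall>i\<in>I. finite_category (D i)) \<and>
       subcategory S (product_category I D) \<and>
       equivalent_categories C S)"
proof
  assume "residually_finite TYPE('u) C"
  with assms show "\<exists>(I :: 'u set) (D :: 'u \<Rightarrow> ('u, 'u) category) S.
       (\<forall>i\<in>I. finite_category (D i)) \<and>
       subcategory S (product_category I D) \<and>
       equivalent_categories C S"
    by (rule equivalent_to_subcategory_if_residually_finite)
next
  assume "\<exists>(I :: 'u set) (D :: 'u \<Rightarrow> ('u, 'u) category) S.
       (\<forall>i\<in>I. finite_category (D i)) \<and>
       subcategory S (product_category I D) \<and>
       equivalent_categories C S"
  then show "residually_finite TYPE('u) C"
    by (elim exE conjE) (rule residually_finite_if_equivalent_to_subcategory)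
qed

end
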